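(* Let $f:\mathbb R^n\to\mathbb R$ be continuously differentiable, $A\in\mathbb R^{m\times n}$ with $m\le n$, $\mathbf b\in\mathbb R^m$, and let $s<m$ be a positive integer. Consider the problem $$(\mathrm P)\qquad \min_{\mathbf x\in\mathbb R^n} f(\mathbf x)\quad\text{s.t.}\quad \|(A\mathbf x-\mathbf b)_+\|_0\le s.$$ For $\mathbf x^*\in\mathbb R^n$ let $J_*=\{i\in\{1,\dots,m\}:(A\mathbf x^*-\mathbf b)_i=0\}$. a) If $\mathbf x^*$ is a local minimizer of $(\mathrm P)$ and $A_{J_*}$ has full row rank, then $\mathbf x^*$ is a KKT point of $(\mathrm P)$. Furthermore, if in addition $\|(A\mathbf x^*-\mathbf b)_+\|_0<s$, then $\boldsymbol\lambda^*=0$ (for the multiplier $\boldsymbol\lambda^*$ in the KKT conditions) and $\nabla f(\mathbf x^* )=0$. b) Suppose $f$ is convex and $\mathbf x^*$ is a KKT point of $(\mathrm P)$. Then $\mathbf x^*$ is a local minimizer of $(\mathrm P)$ if $\|(A\mathbf x^*-\mathbf b)_+\|_0=s$, and a global minimizer of $(\mathrm P)$ if $\|(A\mathbf x^*-\mathbf b)_+\|_0<s$.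
   Context: For $\mathbf u\in\mathbb R^m$, $\mathbf u_+$ is the entrywise positive part $\max\{u_i,0\}$ and $\|\cdot\|_0$ counts nonzero entries. $A_J$ is the submatrix of rows of $A$ indexed by $J$. Let $S=\{\mathbf u\in\mathbb R^m:\|\mathbf u_+\|_0\le s\}$. For a nonempty set $\Omega$ and $\mathbf z\in\Omega$, the Bouligand tangent cone is $T_\Omega(\mathbf z)=\{\mathbf d:\ \exists\,\eta_k\ge 0,\ \{\mathbf z^k\}\subseteq\Omega,\ \mathbf z^k\to\mathbf z,\ \eta_k(\mathbf z^k-\mathbf z)\to\mathbf d\}$ and the Fréchet normal cone is $\widehat N_\Omega(\mathbf z)=\{\mathbf d:\langle\mathbf d,\mathbf u\rangle\le0\ \forall\,\mathbf u\in T_\Omega(\mathbf z)\}$. A point $\mathbf x^*\in\mathbb R^n$ is a KKT point of $(\mathrm P)$ if there is $\boldsymbol\lambda^*\in\mathbb R^m$ such that $\nabla f(\mathbf x^* )+A^\top\boldsymbol\lambda^*=0$, $\boldsymbol\lambda^*\in\widehat N_S(A\mathbf x^*-\mathbf b)$ and $\|(A\mathbf x^*-\mathbf b)_+\|_0\le s$. *)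

theory Defs
  imports "HOL-Analysis.Analysis"
begin

definition grad :: "('a::real_inner \<Rightarrow> real) \<Rightarrow> 'a \<Rightarrow> 'a" where
  "grad f x = (THE D. GDERIV f x :> D)"

lemma grad_eqI:
  assumes "GDERIV f x :> D"
  shows "grad f x = D"
  unfolding grad_def
proof (rule the_equality)
  show "GDERIV f x :> D" by fact
next
  fix E assume "GDERIV f x :> E"
  with assms have "(\<lambda>h. inner h E) = (\<lambda>h. inner h D)"
    unfolding gderiv_def by (rule has_derivative_unique[rotated])
  then have "inner (E - D) E = inner (E - D) D" by metis
  then have "inner (E - D) (E - D) = 0" by (simp add: inner_diff_right)
  then show "E = D" by simp
qed

definition continuously_differentiable :: "('a::real_inner \<Rightarrow> real) \<Rightarrow> bool" where
  "continuously_differentiable f \<longleftrightarrow>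
     (\<forall>x. f differentiable (at x)) \<and> continuous_on UNIV (grad f)"

lemma differentiable_grad:
  fixes f :: "'a::euclidean_space \<Rightarrow> real"
  assumes "f differentiable (at x)"
  shows "GDERIV f x :> grad f x"
proof -
  obtain f' where f': "(f has_derivative f') (at x)"
    using assms by (auto simp: differentiable_def)
  then interpret bounded_linear f' by (rule has_derivative_bounded_linear)
  have "f' = (\<lambda>h. inner h (adjoint f' 1))"
    using adjoint_works[OF linear_axioms, of _ 1] by (simp add: fun_eq_iff)
  with f' have "GDERIV f x :> adjoint f' 1" by (simp add: gderiv_def)
  then show ?thesis using grad_eqI by metis
qed

definition pos_part :: "real ^ 'm \<Rightarrow> real ^ 'm" where
  "pos_part u = (\<chi> i. max (u $ i) 0)"

definition l0_norm :: "real ^ 'm \<Rightarrow> nat" where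
  "l0_norm u = card {i. u $ i \<noteq> 0}"

definition S_set :: "nat \<Rightarrow> (real ^ 'm) set" where
  "S_set s = {u. l0_norm (pos_part u) \<le> s}"

text \<open>The two cones are meant for \<open>z \<in> \<Omega>\<close>. The definition of a multiplier
  below requires membership separately, so their values at other points are irrelevant.\<close>

definition bouligand_tangent_cone :: "'a::real_inner set \<Rightarrow> 'a \<Rightarrow> 'a set" where
  "bouligand_tangent_cone \<Omega> z =
     {d. \<exists>(\<eta> :: nat \<Rightarrow> real) (w :: nat \<Rightarrow> 'a).
           (\<forall>k. \<eta> k \<ge> 0) \<and> (\<forall>k. w k \<in> \<Omega>) \<and> w \<longlonglongrightarrow> z \<and>
           (\<lambda>k. \<eta> k *\<^sub>R (w k - z)) \<longlonglongrightarrow> d}"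

definition frechet_normal_cone :: "'a::real_inner set \<Rightarrow> 'a \<Rightarrow> 'a set" where
  "frechet_normal_cone \<Omega> z = {d. \<forall>u \<in> bouligand_tangent_cone \<Omega> z. inner d u \<le> 0}"

text \<open>The submatrix \<open>A\<^sub>J\<close> is represented by its rows, since its number of rows
  depends on \<open>J\<close>. As in \<open>rank\<close>, its rank is the dimension of the span of these rows;
  repeated rows collapse in the set but are still counted by \<open>card J\<close>.
  For empty \<open>J\<close> the condition holds.\<close>

definition full_row_rank_on :: "real ^ 'n ^ 'm \<Rightarrow> 'm set \<Rightarrow> bool" where
  "full_row_rank_on A J \<longleftrightarrow> dim ((\<lambda>i. row i A) ` J) = card J"

definition feasible_set :: "real ^ 'n ^ 'm \<Rightarrow> real ^ 'm \<Rightarrow> nat \<Rightarrow> (real ^ 'n) set" where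
  "feasible_set A b s = {x. l0_norm (pos_part (A *v x - b)) \<le> s}"

definition global_minimizer_on :: "('a \<Rightarrow> real) \<Rightarrow> 'a set \<Rightarrow> 'a \<Rightarrow> bool" where
  "global_minimizer_on f X x \<longleftrightarrow> x \<in> X \<and> (\<forall>y \<in> X. f x \<le> f y)"

definition local_minimizer_on :: "('a::metric_space \<Rightarrow> real) \<Rightarrow> 'a set \<Rightarrow> 'a \<Rightarrow> bool" where
  "local_minimizer_on f X x \<longleftrightarrow> x \<in> X \<and> (\<exists>e>0. \<forall>y \<in> X \<inter> ball x e. f x \<le> f y)"

definition kkt_multiplier ::
  "(real ^ 'n \<Rightarrow> real) \<Rightarrow> real ^ 'n ^ 'm \<Rightarrow> real ^ 'm \<Rightarrow> nat \<Rightarrow> real ^ 'n \<Rightarrow> real ^ 'm \<Rightarrow> bool" where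
  "kkt_multiplier f A b s x \<mu> \<longleftrightarrow>
     grad f x + transpose A *v \<mu> = 0 \<and>
     \<mu> \<in> frechet_normal_cone (S_set s) (A *v x - b) \<and>
     l0_norm (pos_part (A *v x - b)) \<le> s"

definition kkt_point ::
  "(real ^ 'n \<Rightarrow> real) \<Rightarrow> real ^ 'n ^ 'm \<Rightarrow> real ^ 'm \<Rightarrow> nat \<Rightarrow> real ^ 'n \<Rightarrow> bool" where
  "kkt_point f A b s x \<longleftrightarrow> (\<exists>\<mu>. kkt_multiplier f A b s x \<mu>)"

end

theory Submission
  imports Defs
begin

text \<open>
  Near one of its points \<open>z\<close>, the set \<open>S_set s\<close> coincides with \<open>z\<close> translated by its tangent
  cone. The reason is that a small move \<open>u\<close> leaves the signs of the nonzero entries of \<open>z\<close> alone,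
  so that the positive entries of \<open>z + u\<close> are those of \<open>z\<close> together with the vanishing entries of
  \<open>z\<close> that \<open>u\<close> pushes up. Call this set \<open>first_order_positives z u\<close>. Then \<open>u\<close> is tangent if and
  only if this set has at most \<open>s\<close> elements (\<open>bouligand_tangent_cone_S_set\<close>). Both parts of the
  theorem follow from this, and the case distinction on the number of positive entries enters only
  because the normal cone is trivial when that number is less than \<open>s\<close>: then every single
  coordinate may become positive, so all multiples of the unit vectors are tangent.

  \<^emph>\<open>Necessity.\<close> If \<open>x\<close> is a local minimizer, then \<open>grad f x\<close> has a nonnegative product with every
  \<open>d\<close> whose image \<open>A *v d\<close> is tangent at \<open>z = A *v x - b\<close>. Tangency depends only on the
  coordinates in \<open>J = {i. z $ i = 0}\<close>. Hence \<open>grad f x\<close> is orthogonal to the common kernel of the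
  rows in \<open>J\<close>, which yields a multiplier \<open>\<mu>\<close> supported on \<open>J\<close>. Full row rank lets every tangent
  \<open>u\<close> be realized on \<open>J\<close> as some \<open>A *v d\<close>, so that \<open>inner \<mu> u = inner \<mu> (A *v d) =
  - inner (grad f x) d \<le> 0\<close>, and \<open>\<mu>\<close> is normal.

  \<^emph>\<open>Sufficiency.\<close> For feasible \<open>y\<close> near \<open>x\<close> the difference \<open>A *v (y - x)\<close> is tangent, so the
  multiplier makes \<open>inner (grad f x) (y - x)\<close> nonnegative and convexity gives \<open>f x \<le> f y\<close>. When
  the normal cone is trivial the gradient vanishes and \<open>y\<close> need not be near \<open>x\<close>.
\<close>

section \<open>The tangent cone of the sparsity set\<close>

definition first_order_positives :: "real ^ 'm \<Rightarrow> real ^ 'm \<Rightarrow> 'm set" where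
  "first_order_positives z u = {i. z $ i > 0 \<or> z $ i = 0 \<and> u $ i > 0}"

lemma l0_norm_pos_part: "l0_norm (pos_part u) = card {i. u $ i > 0}"
  unfolding l0_norm_def pos_part_def by (rule arg_cong[where f = card]) auto

lemma mem_S_set_iff: "u \<in> S_set s \<longleftrightarrow> card {i. u $ i > 0} \<le> s"
  by (simp add: S_set_def l0_norm_pos_part)

lemma mem_feasible_set_iff: "x \<in> feasible_set A b s \<longleftrightarrow> A *v x - b \<in> S_set s"
  by (simp add: feasible_set_def S_set_def)

lemma eventually_positives_along_ray:
  fixes z u :: "real ^ 'm"
  shows "eventually (\<lambda>t. {i. (z + t *\<^sub>R u) $ i > 0} \<subseteq> first_order_positives z u) (at_right 0)"
proof -
  have "eventually (\<lambda>t. (z + t *\<^sub>R u) $ i > 0 \<longrightarrow> i \<in> first_order_positives z u) (at_right 0)" for i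
  proof (cases "z $ i < 0")
    case True
    have "((\<lambda>t. z $ i + t * u $ i) \<longlongrightarrow> z $ i + 0 * u $ i) (at_right 0)"
      by (intro tendsto_intros)
    then have "eventually (\<lambda>t. z $ i + t * u $ i < 0) (at_right 0)"
      using True by (intro order_tendstoD(2)) auto
    then show ?thesis
      by eventually_elim auto
  next
    case False
    show ?thesis
      using eventually_at_right_less[of "0::real"]
    proof eventually_elim
      case (elim t)
      then show ?case
        using False by (cases "z $ i = 0") (auto simp: first_order_positives_def zero_less_mult_iff)
    qed
  qed
  then have "eventually (\<lambda>t. \<forall>i. (z + t *\<^sub>R u) $ i > 0 \<longrightarrow> i \<in> first_order_positives z u)
      (at_right 0)"
    by (rule eventually_all_finite)
  then show ?thesis
    by eventually_elim blast
qed

lemma eventually_S_set_along_ray: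
  assumes "card (first_order_positives z u) \<le> s"
  shows "eventually (\<lambda>t. z + t *\<^sub>R u \<in> S_set s) (at_right 0)"
  using eventually_positives_along_ray[of z u]
proof eventually_elim
  case (elim t)
  then show ?case
    using assms card_mono[OF _ elim] by (simp add: mem_S_set_iff)
qed

text \<open>
  This bounds the first-order count of \<open>w - z\<close> by the positive entries of a nearby point \<open>w\<close>. The
  factor \<open>\<eta>\<close> is the one in the definition of the tangent cone; \<open>\<eta> = 1\<close> serves for differences of
  feasible points.
\<close>

lemma first_order_positives_scaled_subset:
  assumes "\<eta> \<ge> 0" and "\<And>i. z $ i > 0 \<Longrightarrow> w $ i > 0"
  shows "first_order_positives z (\<eta> *\<^sub>R (w - z)) \<subseteq> {i. w $ i > 0}"
  using assms by (auto simp: first_order_positives_def zero_less_mult_iff)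

lemma eventually_positives_persist:
  fixes z :: "real ^ 'm"
  shows "eventually (\<lambda>w. \<forall>i. z $ i > 0 \<longrightarrow> w $ i > 0) (nhds z)"
proof (rule eventually_all_finite)
  fix i
  have "((\<lambda>w. w $ i) \<longlongrightarrow> z $ i) (nhds z)"
    by (intro tendsto_intros filterlim_ident)
  then show "eventually (\<lambda>w. z $ i > 0 \<longrightarrow> w $ i > 0) (nhds z)"
    by (cases "z $ i > 0") (auto dest: order_tendstoD(1))
qed

lemma eventually_first_order_positives_limit:
  fixes z d :: "real ^ 'm"
  assumes "(v \<longlongrightarrow> d) F"
  shows "eventually (\<lambda>k. first_order_positives z d \<subseteq> first_order_positives z (v k)) F"
proof -
  have "eventually (\<lambda>k. \<forall>i. d $ i > 0 \<longrightarrow> v k $ i > 0) F"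
    using assms eventually_positives_persist by (auto simp: filterlim_iff)
  then show ?thesis
    by eventually_elim (auto simp: first_order_positives_def)
qed

text \<open>
  For a limit \<open>u\<close> of scaled differences, the entries counted by \<open>first_order_positives z u\<close> are
  positive in some approximating point of the set, so there are at most \<open>s\<close> of them. Conversely,
  such a \<open>u\<close> is the direction of a segment that starts at \<open>z\<close> and stays in the set.
\<close>

theorem bouligand_tangent_cone_S_set:
  fixes z :: "real ^ 'm"
  shows "bouligand_tangent_cone (S_set s) z = {u. card (first_order_positives z u) \<le> s}"
proof (intro set_eqI iffI)
  fix u
  assume "u \<in> bouligand_tangent_cone (S_set s) z"
  then obtain \<eta> :: "nat \<Rightarrow> real" and w where
    \<eta>: "\<And>k. \<eta> k \<ge> 0" and w: "\<And>k. w k \<in> S_set s" "w \<longlonglongrightarrow> z"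
    and u: "(\<lambda>k. \<eta> k *\<^sub>R (w k - z)) \<longlonglongrightarrow> u"
    unfolding bouligand_tangent_cone_def by blast
  have "eventually (\<lambda>k. \<forall>i. z $ i > 0 \<longrightarrow> w k $ i > 0) sequentially"
    using w(2) eventually_positives_persist by (auto simp: filterlim_iff)
  with eventually_first_order_positives_limit[OF u, of z]
  have "eventually (\<lambda>k. first_order_positives z u \<subseteq> {i. w k $ i > 0}) sequentially"
  proof eventually_elim
    case (elim k)
    then show ?case
      using first_order_positives_scaled_subset[OF \<eta>[of k], of z "w k"] by blast
  qed
  then obtain k where "first_order_positives z u \<subseteq> {i. w k $ i > 0}"
    by (auto simp: eventually_sequentially)
  then have "card (first_order_positives z u) \<le> card {i. w k $ i > 0}"
    by (intro card_mono) auto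
  then show "u \<in> {u. card (first_order_positives z u) \<le> s}"
    using w(1)[of k] by (simp add: mem_S_set_iff)
next
  fix u
  assume "u \<in> {u. card (first_order_positives z u) \<le> s}"
  then have "eventually (\<lambda>t. z + t *\<^sub>R u \<in> S_set s) (at_right 0)"
    by (intro eventually_S_set_along_ray) simp
  then obtain e where e: "e > 0" "\<And>t. 0 < t \<Longrightarrow> t < e \<Longrightarrow> z + t *\<^sub>R u \<in> S_set s"
    by (auto simp: eventually_at_right_field)
  \<comment> \<open>The denominator starts at \<open>2\<close> so that every step is strictly shorter than \<open>e\<close>.\<close>
  define t where "t k = e / real (k + 2)" for k
  have t: "t k > 0" "t k < e" for k
    using e(1) by (auto simp: t_def field_simps intro: add_strict_increasing)
  have "t \<longlonglongrightarrow> 0"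
    unfolding t_def by (rule LIMSEQ_ignore_initial_segment[OF lim_const_over_n])
  then have "(\<lambda>k. z + t k *\<^sub>R u) \<longlonglongrightarrow> z + 0 *\<^sub>R u"
    by (intro tendsto_intros)
  moreover have "(\<lambda>k. inverse (t k) *\<^sub>R ((z + t k *\<^sub>R u) - z)) = (\<lambda>k. u)"
    using t(1) by (auto simp: fun_eq_iff less_imp_neq[THEN not_sym])
  ultimately show "u \<in> bouligand_tangent_cone (S_set s) z"
    unfolding bouligand_tangent_cone_def using e(2) t
    by (intro CollectI exI[of _ "\<lambda>k. inverse (t k)"] exI[of _ "\<lambda>k. z + t k *\<^sub>R u"])
      (auto simp: less_imp_le)
qed

text \<open>
  The set lies locally in its translated tangent cone, without an error term. This is why
  first-order conditions suffice for a local minimum although the set is not convex.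
\<close>

lemma eventually_diff_tangent_S_set:
  fixes z :: "real ^ 'm"
  shows "eventually (\<lambda>w. w \<in> S_set s \<longrightarrow> w - z \<in> bouligand_tangent_cone (S_set s) z) (nhds z)"
  using eventually_positives_persist[of z]
proof eventually_elim
  case (elim w)
  then have "first_order_positives z (w - z) \<subseteq> {i. w $ i > 0}"
    using first_order_positives_scaled_subset[of 1 z w] by simp
  then have "card (first_order_positives z (w - z)) \<le> card {i. w $ i > 0}"
    by (intro card_mono) auto
  then show ?case
    by (auto simp: bouligand_tangent_cone_S_set mem_S_set_iff)
qed

text \<open>
  With fewer than \<open>s\<close> positive entries, any one coordinate may be moved in either direction, so the
  tangent cone contains every coordinate axis, and a normal vector is orthogonal to all of them.
\<close>

lemma frechet_normal_cone_S_set_slack: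
  fixes z :: "real ^ 'm"
  assumes slack: "card {i. z $ i > 0} < s" and \<mu>: "\<mu> \<in> frechet_normal_cone (S_set s) z"
  shows "\<mu> = 0"
proof -
  have "axis i c \<in> bouligand_tangent_cone (S_set s) z" for i and c :: real
  proof -
    have "first_order_positives z (axis i c) \<subseteq> insert i {i. z $ i > 0}"
      by (auto simp: first_order_positives_def axis_def split: if_splits)
    then have "card (first_order_positives z (axis i c)) \<le> card (insert i {i. z $ i > 0})"
      by (intro card_mono) auto
    also have "\<dots> \<le> Suc (card {i. z $ i > 0})"
      by (rule card_insert_le_m1) auto
    finally show ?thesis
      using slack by (simp add: bouligand_tangent_cone_S_set)
  qed
  then have "inner \<mu> (axis i c) \<le> 0" for i and c :: real
    using \<mu> by (simp add: frechet_normal_cone_def)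
  from this[of _ 1] this[of _ "-1"] have "\<mu> $ i = 0" for i
    by (intro antisym) (auto simp: inner_axis)
  then show ?thesis
    by (simp add: vec_eq_iff)
qed

section \<open>Rows of a matrix indexed by a subset\<close>

lemma full_row_rank_interpolation:
  fixes A :: "real ^ 'n ^ 'm" and u :: "real ^ 'm"
  assumes "full_row_rank_on A J"
  obtains d where "\<And>i. i \<in> J \<Longrightarrow> (A *v d) $ i = u $ i"
proof -
  let ?r = "\<lambda>i. row i A"
  have dim: "dim (?r ` J) = card J"
    using assms by (simp add: full_row_rank_on_def)
  have "dim (?r ` J) \<le> card (?r ` J)" "card (?r ` J) \<le> card J"
    by (auto intro: dim_le_card' card_image_le)
  with dim have card: "card (?r ` J) = card J"
    by simp
  then have inj: "inj_on ?r J"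
    by (intro eq_card_imp_inj_on) auto
  have "independent (?r ` J)"
    using card dim by (intro card_le_dim_spanning[of _ "span (?r ` J)"]) (auto intro: span_base)
  \<comment> \<open>Independent rows admit a linear functional with prescribed values on them, and its
    representing vector is \<open>d\<close>.\<close>
  then obtain g :: "real ^ 'n \<Rightarrow> real" where
    g: "linear g" "\<And>y. y \<in> ?r ` J \<Longrightarrow> g y = u $ (the_inv_into J ?r y)"
    using linear_independent_extend[of "?r ` J" "\<lambda>y. u $ (the_inv_into J ?r y)"] by blast
  have "(A *v adjoint g 1) $ i = u $ i" if "i \<in> J" for i
  proof -
    have "(A *v adjoint g 1) $ i = inner (row i A) (adjoint g 1)"
      by (simp add: matrix_mult_dot row_def)
    also have "\<dots> = g (row i A)"
      using adjoint_works[OF g(1), of "row i A" 1] by simp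
    also have "\<dots> = u $ i"
      using that g(2)[of "row i A"] the_inv_into_f_f[OF inj that] by simp
    finally show ?thesis .
  qed
  then show ?thesis
    using that by blast
qed

text \<open>
  The orthogonal complement of the kernel of the submatrix is its row space. The coefficients are
  extended by zero to all rows, which turns the combination into a product with \<open>transpose A\<close>.
\<close>

lemma orthogonal_kernel_rows_imp_combination:
  fixes A :: "real ^ 'n ^ 'm" and g :: "real ^ 'n"
  assumes "\<And>d. (\<And>i. i \<in> J \<Longrightarrow> (A *v d) $ i = 0) \<Longrightarrow> inner g d = 0"
  obtains \<mu> where "transpose A *v \<mu> = g" and "\<And>i. i \<notin> J \<Longrightarrow> \<mu> $ i = 0"
proof -
  let ?R = "(\<lambda>i. row i A) ` J"
  let ?C = "(\<lambda>\<mu>. transpose A *v \<mu>) ` {\<mu>. \<forall>i. i \<notin> J \<longrightarrow> \<mu> $ i = 0}"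
  have "subspace ?C"
    by (intro linear_subspace_image matrix_vector_mul_linear) (auto simp: subspace_def)
  moreover have "?R \<subseteq> ?C"
  proof
    fix y assume "y \<in> ?R"
    then obtain i where i: "i \<in> J" "y = row i A"
      by blast
    then have "y = transpose A *v axis i 1"
      by (simp add: matrix_vector_mul_component vec_eq_iff row_def transpose_def
          matrix_vector_mult_basis column_def)
    moreover have "axis i 1 \<in> {\<mu> :: real ^ 'm. \<forall>j. j \<notin> J \<longrightarrow> \<mu> $ j = 0}"
      using i by (auto simp: axis_def)
    ultimately show "y \<in> ?C"
      by blast
  qed
  ultimately have span: "span ?R \<subseteq> ?C"
    by (intro span_minimal)
  obtain y z where yz: "y \<in> span ?R" "\<And>w. w \<in> span ?R \<Longrightarrow> orthogonal z w" "g = y + z"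
    using orthogonal_subspace_decomp_exists[of ?R g] by metis
  have "(A *v z) $ i = 0" if "i \<in> J" for i
  proof -
    have "inner z (row i A) = 0"
      using yz(2) that by (auto simp: orthogonal_def intro: span_base)
    then show ?thesis
      by (simp add: matrix_mult_dot row_def inner_commute)
  qed
  then have "inner g z = 0"
    by (rule assms)
  moreover have "inner y z = 0"
    using yz(1,2) by (metis orthogonal_def inner_commute)
  ultimately have "z = 0"
    using yz(3) by (simp add: inner_add_left)
  then have "g \<in> ?C"
    using yz(1,3) span by auto
  then show ?thesis
    using that by blast
qed

section \<open>First-order conditions along rays\<close>

lemma DERIV_along_ray:
  fixes f :: "real ^ 'n \<Rightarrow> real"
  assumes "f differentiable (at x)"
  shows "((\<lambda>t. f (x + t *\<^sub>R d)) has_real_derivative inner (grad f x) d) (at 0)"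
proof -
  have "(f has_derivative (\<lambda>h. inner h (grad f x))) (at (x + 0 *\<^sub>R d))"
    using differentiable_grad[OF assms] by (simp add: gderiv_def)
  moreover have "((\<lambda>t::real. x + t *\<^sub>R d) has_derivative (\<lambda>t. t *\<^sub>R d)) (at 0)"
    by (auto intro!: derivative_eq_intros)
  ultimately have "((\<lambda>t. f (x + t *\<^sub>R d)) has_derivative (\<lambda>t. inner (t *\<^sub>R d) (grad f x))) (at 0)"
    by (rule has_derivative_compose[rotated])
  then show ?thesis
    by (simp add: has_field_derivative_def inner_commute mult.commute[of _ "inner _ _"])
qed

lemma local_minimizer_on_feasible_ray:
  fixes f :: "real ^ 'n \<Rightarrow> real"
  assumes "f differentiable (at x)" and "local_minimizer_on f X x"
    and "eventually (\<lambda>t. x + t *\<^sub>R d \<in> X) (at_right 0)"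
  shows "inner (grad f x) d \<ge> 0"
proof (rule ccontr)
  assume "\<not> inner (grad f x) d \<ge> 0"
  then obtain e where e: "e > 0" "\<And>t. 0 < t \<Longrightarrow> t < e \<Longrightarrow> f (x + t *\<^sub>R d) < f x"
    using DERIV_neg_dec_right[OF DERIV_along_ray[OF assms(1), of d]] by auto
  obtain r where r: "r > 0" "\<And>y. y \<in> X \<inter> ball x r \<Longrightarrow> f x \<le> f y"
    using assms(2) by (auto simp: local_minimizer_on_def)
  have "((\<lambda>t. x + t *\<^sub>R d) \<longlongrightarrow> x + 0 *\<^sub>R d) (at_right 0)"
    by (intro tendsto_intros)
  then have "eventually (\<lambda>t. x + t *\<^sub>R d \<in> ball x r) (at_right 0)"
    using r(1) by (intro topological_tendstoD) auto
  moreover have "eventually (\<lambda>t. 0 < t \<and> t < e) (at_right 0)"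
    using e(1) by (auto simp: eventually_at_right_field)
  ultimately have "eventually (\<lambda>t. False) (at_right (0::real))"
    using assms(3)
  proof eventually_elim
    case (elim t)
    then show ?case
      using e(2)[of t] r(2)[of "x + t *\<^sub>R d"] by auto
  qed
  then show False
    by simp
qed

lemma convex_on_above_grad:
  fixes f :: "real ^ 'n \<Rightarrow> real"
  assumes "convex_on UNIV f" and "f differentiable (at x)"
  shows "f y \<ge> f x + inner (grad f x) (y - x)"
proof -
  let ?g = "\<lambda>t. f (x + t *\<^sub>R (y - x))"
  have "convex_on UNIV ?g"
  proof (rule convex_onI)
    fix t a c :: real
    assume t: "0 < t" "t < 1"
    have "x + ((1 - t) *\<^sub>R a + t *\<^sub>R c) *\<^sub>R (y - x)
        = (1 - t) *\<^sub>R (x + a *\<^sub>R (y - x)) + t *\<^sub>R (x + c *\<^sub>R (y - x))"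
      by (simp add: algebra_simps)
    then show "?g ((1 - t) *\<^sub>R a + t *\<^sub>R c) \<le> (1 - t) * ?g a + t * ?g c"
      using convex_onD[OF assms(1), of t] t by simp
  qed auto
  then have "?g 1 - ?g 0 \<ge> inner (grad f x) (y - x) * (1 - 0)"
    using DERIV_along_ray[OF assms(2)]
    by (intro convex_on_imp_above_tangent[where A = UNIV]) auto
  then show ?thesis
    by simp
qed

section \<open>KKT points\<close>

lemma inner_grad_kkt_multiplier:
  assumes "kkt_multiplier f A b s x \<mu>"
  shows "inner (grad f x) d = - inner \<mu> (A *v d)"
proof -
  have "grad f x = - (transpose A *v \<mu>)"
    using assms by (simp add: kkt_multiplier_def eq_neg_iff_add_eq_0)
  then show ?thesis
    by (simp add: dot_lmul_matrix[symmetric] inner_commute)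
qed

lemma kkt_multiplier_slack:
  assumes "kkt_multiplier f A b s x \<mu>" and "l0_norm (pos_part (A *v x - b)) < s"
  shows "\<mu> = 0" and "grad f x = 0"
proof -
  show "\<mu> = 0"
    using assms by (intro frechet_normal_cone_S_set_slack[of "A *v x - b" s])
      (auto simp: kkt_multiplier_def l0_norm_pos_part)
  then show "grad f x = 0"
    using assms(1) by (simp add: kkt_multiplier_def)
qed

lemma local_minimizer_imp_kkt_point:
  fixes f :: "real ^ 'n \<Rightarrow> real" and A :: "real ^ 'n ^ 'm"
  assumes diff: "f differentiable (at x)"
    and min: "local_minimizer_on f (feasible_set A b s) x"
    and rank: "full_row_rank_on A {i. (A *v x - b) $ i = 0}"
  shows "kkt_point f A b s x"
proof -
  define z where "z = A *v x - b"
  define J where "J = {i. z $ i = 0}"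
  have feas: "z \<in> S_set s"
    using min by (simp add: local_minimizer_on_def mem_feasible_set_iff z_def)
  have grad_nonneg: "inner (grad f x) d \<ge> 0" if "card (first_order_positives z (A *v d)) \<le> s" for d
  proof (rule local_minimizer_on_feasible_ray[OF diff min])
    have "A *v (x + t *\<^sub>R d) - b = z + t *\<^sub>R (A *v d)" for t
      by (simp add: z_def matrix_vector_right_distrib matrix_vector_mult_scaleR)
    then show "eventually (\<lambda>t. x + t *\<^sub>R d \<in> feasible_set A b s) (at_right 0)"
      using eventually_S_set_along_ray[OF that] by (simp add: mem_feasible_set_iff)
  qed
  have tangency_on_J: "first_order_positives z u = first_order_positives z v"
    if "\<And>i. i \<in> J \<Longrightarrow> u $ i = v $ i" for u v
    using that by (auto simp: first_order_positives_def J_def)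
  \<comment> \<open>Directions \<open>d\<close> and \<open>- d\<close> in the kernel on \<open>J\<close> are both feasible, since \<open>0\<close> is tangent.\<close>
  have "inner (- grad f x) d = 0" if "\<And>i. i \<in> J \<Longrightarrow> (A *v d) $ i = 0" for d
  proof -
    have zero: "card (first_order_positives z 0) \<le> s"
      using feas by (simp add: first_order_positives_def mem_S_set_iff)
    have "first_order_positives z (A *v d) = first_order_positives z 0"
      "first_order_positives z (A *v (- d)) = first_order_positives z 0"
      using that matrix_vector_mult_scaleR[of A "-1" d] by (auto intro!: tangency_on_J)
    then show ?thesis
      using grad_nonneg[of d] grad_nonneg[of "- d"] zero by simp
  qed
  then obtain \<mu> where \<mu>: "transpose A *v \<mu> = - grad f x" "\<And>i. i \<notin> J \<Longrightarrow> \<mu> $ i = 0"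
    using orthogonal_kernel_rows_imp_combination[of J A "- grad f x"] by blast
  have "inner \<mu> u \<le> 0" if u: "card (first_order_positives z u) \<le> s" for u
  proof -
    obtain d where d: "\<And>i. i \<in> J \<Longrightarrow> (A *v d) $ i = u $ i"
      using full_row_rank_interpolation[of A J] rank unfolding J_def z_def by metis
    have "inner \<mu> u = inner \<mu> (A *v d)"
      unfolding inner_vec_def using d \<mu>(2) by (intro sum.cong refl) (metis inner_zero_left)
    also have "\<dots> = - inner (grad f x) d"
      using \<mu>(1) by (metis dot_lmul_matrix inner_minus_left transpose_matrix_vector)
    also have "\<dots> \<le> 0"
      using grad_nonneg[of d] tangency_on_J[OF d] u by simp
    finally show ?thesis .
  qed
  then have "\<mu> \<in> frechet_normal_cone (S_set s) z"
    by (simp add: frechet_normal_cone_def bouligand_tangent_cone_S_set)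
  then have "kkt_multiplier f A b s x \<mu>"
    using \<mu>(1) feas by (simp add: kkt_multiplier_def z_def S_set_def)
  then show ?thesis
    by (auto simp: kkt_point_def)
qed

text \<open>
  The multiplier is tested only against \<open>A *v (y - x)\<close> for feasible \<open>y\<close> so close to \<open>x\<close> that this
  vector is tangent; farther away, feasible points may have other positive entries than those
  near \<open>x\<close>, and \<open>f\<close> may be smaller there.
\<close>

lemma convex_kkt_point_imp_local_minimizer:
  fixes f :: "real ^ 'n \<Rightarrow> real" and A :: "real ^ 'n ^ 'm"
  assumes "convex_on UNIV f" and "f differentiable (at x)" and "kkt_point f A b s x"
  shows "local_minimizer_on f (feasible_set A b s) x"
proof -
  define z where "z = A *v x - b"
  obtain \<mu> where \<mu>: "kkt_multiplier f A b s x \<mu>"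
    using assms(3) by (auto simp: kkt_point_def)
  have "((\<lambda>y. A *v y - b) \<longlongrightarrow> z) (nhds x)"
    unfolding z_def
    by (intro tendsto_intros filterlim_ident
        bounded_linear.tendsto[OF matrix_vector_mul_bounded_linear])
  then have "eventually (\<lambda>y. A *v y - b \<in> S_set s \<longrightarrow>
      (A *v y - b) - z \<in> bouligand_tangent_cone (S_set s) z) (nhds x)"
    using eventually_diff_tangent_S_set[of s z] by (auto simp: filterlim_iff)
  then have "eventually (\<lambda>y. y \<in> feasible_set A b s \<longrightarrow> f x \<le> f y) (nhds x)"
  proof eventually_elim
    case (elim y)
    show ?case
    proof
      assume "y \<in> feasible_set A b s"
      moreover have "(A *v y - b) - z = A *v (y - x)"
        by (simp add: z_def matrix_vector_mult_diff_distrib)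
      ultimately have "A *v (y - x) \<in> bouligand_tangent_cone (S_set s) z"
        using elim by (simp add: mem_feasible_set_iff)
      then have "inner \<mu> (A *v (y - x)) \<le> 0"
        using \<mu> by (simp add: kkt_multiplier_def frechet_normal_cone_def z_def)
      then show "f x \<le> f y"
        using convex_on_above_grad[OF assms(1,2), of y] inner_grad_kkt_multiplier[OF \<mu>, of "y - x"]
        by simp
    qed
  qed
  then have "\<exists>e>0. \<forall>y \<in> feasible_set A b s \<inter> ball x e. f x \<le> f y"
    by (auto simp: eventually_nhds_metric dist_commute)
  moreover have "x \<in> feasible_set A b s"
    using \<mu> by (simp add: kkt_multiplier_def feasible_set_def)
  ultimately show ?thesis
    by (simp add: local_minimizer_on_def)
qed

lemma convex_kkt_point_slack_imp_global_minimizer: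
  fixes f :: "real ^ 'n \<Rightarrow> real" and A :: "real ^ 'n ^ 'm"
  assumes "convex_on UNIV f" and "f differentiable (at x)" and "kkt_point f A b s x"
    and slack: "l0_norm (pos_part (A *v x - b)) < s"
  shows "global_minimizer_on f (feasible_set A b s) x"
proof -
  have "grad f x = 0"
    using assms(3) slack kkt_multiplier_slack(2) by (auto simp: kkt_point_def)
  then have "f x \<le> f y" for y
    using convex_on_above_grad[OF assms(1,2), of y] by simp
  then show ?thesis
    using slack by (simp add: global_minimizer_on_def feasible_set_def)
qed

theorem theorem3p2:
  fixes f :: "real ^ 'n \<Rightarrow> real"
    and A :: "real ^ 'n ^ 'm"
    and b :: "real ^ 'm"
    and s :: nat
    and x :: "real ^ 'n"
  assumes "continuously_differentiable f"
    and "CARD('m) \<le> CARD('n)"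
    and "0 < s"
    and "s < CARD('m)"
  shows
    "(local_minimizer_on f (feasible_set A b s) x \<and>
      full_row_rank_on A {i. (A *v x - b) $ i = 0} \<longrightarrow>
        kkt_point f A b s x \<and>
        (l0_norm (pos_part (A *v x - b)) < s \<longrightarrow>
          (\<forall>\<mu>. kkt_multiplier f A b s x \<mu> \<longrightarrow> \<mu> = 0) \<and> grad f x = 0))
     \<and>
     (convex_on UNIV f \<and> kkt_point f A b s x \<longrightarrow>
        (l0_norm (pos_part (A *v x - b)) = s \<longrightarrow>
          local_minimizer_on f (feasible_set A b s) x) \<and>
        (l0_norm (pos_part (A *v x - b)) < s \<longrightarrow>
          global_minimizer_on f (feasible_set A b s) x))"
proof -
  have diff: "f differentiable (at x)"
    using assms(1) by (simp add: continuously_differentiable_def)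
  show ?thesis
    using local_minimizer_imp_kkt_point[OF diff, of A b s] kkt_multiplier_slack[of f A b s x]
      convex_kkt_point_imp_local_minimizer[OF _ diff, of A b s]
      convex_kkt_point_slack_imp_global_minimizer[OF _ diff, of A b s]
    unfolding kkt_point_def by blast
qed

end
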